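(* Let $n\ge 1$. For every signed permutation $\pi\in B_n$ other than the identity $\mathrm{id}$, $$\mathrm{maxdrop}_B(\mathrm{bubble}_B(\pi))=\mathrm{maxdrop}_B(\pi)-1.$$ For every signed permutation $\pi\in B_n$, $$\mathrm{maxdrop}_B(\pi)=\mathrm{bsc}_B(\pi).$$
   Context: $B_n$ denotes the group of signed permutations: bijections $\pi$ of $\{-n,\dots,n\}$ with $\pi(-i)=-\pi(i)$ (so $\pi(0)=0$), written in one-line notation $\pi=\pi(1),\dots,\pi(n)$. Let $\tau_0=-1,2,3,\dots,n$, and for $1\le i\le n-1$ let $\tau_i$ be the adjacent transposition $(i,i+1)$; thus $\pi\tau_0$ is $\pi$ with the sign of $\pi(1)$ changed, and $\pi\tau_i$ is $\pi$ with the entries $\pi(i)$ and $\pi(i+1)$ switched. The type B descent set is $\mathrm{DES}_B(\pi)=\{i\in\{0,\dots,n-1\}:\pi(i)>\pi(i+1)\}$, with $\pi(0)=0$. For $0\le i\le n-1$ define $s_i:B_n\to B_n$ by $s_i(\pi)=\pi\tau_i$ if $i\in\mathrm{DES}_B(\pi)$ and $s_i(\pi)=\pi$ otherwise. The type B bubble sort is $\mathrm{bubble}_B=s_{n-1}\circ s_{n-2}\circ\cdots\circ s_0$ (so $s_0$ is applied first). The type B bubble sort complexity is $\mathrm{bsc}_B(\pi)=\min\{k\ge 0:\mathrm{bubble}_B^k(\pi)=\mathrm{id}\}$. The type B maximum drop is $$\mathrm{maxdrop}_B(\pi)=\max\Big\{\max\{i-\pi(i): 1\le i\le n,\ \pi(i)>0\},\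 \max\{i: 1\le i\le n,\ \pi(i)<0\}\Big\},$$ where an empty inner maximum is disregarded. *)

theory Defs
  imports "HOL-Combinatorics.Permutations"
begin

(* A signed permutation of {-n..n} is represented by its extension by the identity to all of int,
   so that composition is function composition and the neutral element is the function id. *)
definition signed_perms :: "nat \<Rightarrow> (int \<Rightarrow> int) set" where
  "signed_perms n =
     {\<pi>. \<pi> permutes {- int n..int n} \<and> (\<forall>i\<in>{- int n..int n}. \<pi> (- i) = - \<pi> i)}"

(* For i > 0 the transposition (i, i+1) must, being an odd function, also swap -i and -(i+1). *)
definition tau :: "nat \<Rightarrow> int \<Rightarrow> int" where
  "tau i =
     (if i = 0 then transpose (- 1) 1
      else transpose (int i) (int i + 1) \<circ> transpose (- int i) (- (int i + 1)))"

definition DES_B :: "nat \<Rightarrow> (int \<Rightarrow> int) \<Rightarrow> nat set" where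
  "DES_B n \<pi> = {i. i < n \<and> \<pi> (int i) > \<pi> (int i + 1)}"

definition sort_step :: "nat \<Rightarrow> nat \<Rightarrow> (int \<Rightarrow> int) \<Rightarrow> (int \<Rightarrow> int)" where
  "sort_step n i \<pi> = (if i \<in> DES_B n \<pi> then \<pi> \<circ> tau i else \<pi>)"

(* fold runs through the list from the left, so the step with index 0 is applied first. *)
definition bubble_B :: "nat \<Rightarrow> (int \<Rightarrow> int) \<Rightarrow> (int \<Rightarrow> int)" where
  "bubble_B n = fold (sort_step n) [0..<n]"

definition bsc_B :: "nat \<Rightarrow> (int \<Rightarrow> int) \<Rightarrow> nat" where
  "bsc_B n \<pi> = (LEAST k. (bubble_B n ^^ k) \<pi> = id)"

(* One maximum over the union of both index families: a family that is empty thereby drops out.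
   For n > 0 and a signed permutation the union is nonempty. *)
definition maxdrop_B :: "nat \<Rightarrow> (int \<Rightarrow> int) \<Rightarrow> int" where
  "maxdrop_B n \<pi> =
     Max ({i - \<pi> i | i. 1 \<le> i \<and> i \<le> int n \<and> \<pi> i > 0} \<union>
          {i | i. 1 \<le> i \<and> i \<le> int n \<and> \<pi> i < 0})"

end

(* Replacing negative entries by 0 turns the type B maximum drop into the maximum of
   i - max (pi i) 0 over 1 <= i <= n.  One pass of bubble sort carries along the running maximum
   M j of |pi 1|, pi 2, ..., pi j, so the result has entries min (M j) (pi (j + 1)) for j < n and
   M n at position n.  Hence its drop at j < n is the maximum of j - M j and the drop of pi at j + 1
   minus one.  If i is the last position in 2..j with a negative entry (or 1 if there is none), the
   distinct positive numbers |pi 1|, pi (i + 1), ..., pi j show M j >= j - i + 1, so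
   j - M j <= i - 1 is also at most the maximum drop of pi minus one. *)
theory Submission
  imports Defs
begin

section \<open>Signed permutations as odd injective maps on the integers\<close>

lemma signed_permsD:
  assumes "\<pi> \<in> signed_perms n"
  shows signed_perms_permutes: "\<pi> permutes {- int n..int n}"
    and signed_perms_minus: "\<pi> (- i) = - \<pi> i"
proof -
  show p: "\<pi> permutes {- int n..int n}"
    using assms by (simp add: signed_perms_def)
  show "\<pi> (- i) = - \<pi> i"
  proof (cases "i \<in> {- int n..int n}")
    case True
    then show ?thesis using assms by (simp add: signed_perms_def)
  next
    case False
    \<comment> \<open>The interval is symmetric, so outside it both \<open>i\<close> and
      \<open>- i\<close> are fixed and oddness extends to all integers.\<close>
    then have "- i \<notin> {- int n..int n}" by auto
    with False show ?thesis using permutes_not_in[OF p] by metis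
  qed
qed

lemma signed_perms_zero [simp]: "\<pi> \<in> signed_perms n \<Longrightarrow> \<pi> 0 = 0"
  using signed_perms_minus[of \<pi> n 0] by simp

lemma signed_perms_inject:
  assumes "\<pi> \<in> signed_perms n"
  shows "\<pi> i = \<pi> j \<longleftrightarrow> i = j"
  using permutes_inj[OF signed_perms_permutes[OF assms]] by (simp add: inj_eq)

lemma signed_perms_eq_0_iff: "\<pi> \<in> signed_perms n \<Longrightarrow> \<pi> i = 0 \<longleftrightarrow> i = 0"
  using signed_perms_inject[of \<pi> n i 0] by simp

lemma signed_perms_abs_le:
  assumes "\<pi> \<in> signed_perms n" "1 \<le> i" "i \<le> int n"
  shows "\<bar>\<pi> i\<bar> \<le> int n"
proof -
  have "\<pi> i \<in> {- int n..int n}"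
    using permutes_in_image[OF signed_perms_permutes[OF assms(1)], of i] assms by auto
  then show ?thesis by auto
qed

text \<open>Oddness reduces equal absolute values to \<open>\<pi> x = \<pi> y\<close> or
  \<open>\<pi> x = \<pi> (- y)\<close>; the second cannot occur between positive positions.\<close>

lemma signed_perms_inj_on_abs:
  assumes "\<pi> \<in> signed_perms n" "A \<subseteq> {1..}"
  shows "inj_on (\<lambda>i. \<bar>\<pi> i\<bar>) A"
proof (rule inj_onI)
  fix x y assume xy: "x \<in> A" "y \<in> A" and eq: "\<bar>\<pi> x\<bar> = \<bar>\<pi> y\<bar>"
  from eq have "\<pi> x = \<pi> y \<or> \<pi> x = \<pi> (- y)"
    using signed_perms_minus[OF assms(1), of y] by linarith
  then have "x = y \<or> x = - y" using signed_perms_inject[OF assms(1)] by metis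
  moreover have "x \<ge> 1" "y \<ge> 1" using xy assms(2) by auto
  ultimately show "x = y" by auto
qed

section \<open>Closure of signed permutations under sorting\<close>

lemma tau_uminus: "tau i (- x) = - tau i x"
  by (auto simp: tau_def transpose_def)

lemma tau_permutes:
  assumes "i < n"
  shows "tau i permutes {- int n..int n}"
proof (cases "i = 0")
  case True
  then show ?thesis using assms unfolding tau_def by (auto intro!: permutes_swap_id)
next
  case False
  then show ?thesis using assms unfolding tau_def
    by (auto intro!: permutes_swap_id permutes_compose)
qed

lemma sort_step_signed_perms:
  assumes "\<pi> \<in> signed_perms n"
  shows "sort_step n i \<pi> \<in> signed_perms n"
proof -
  have "\<pi> \<circ> tau i \<in> signed_perms n" if "i < n"
    using permutes_compose[OF tau_permutes[OF that] signed_perms_permutes[OF assms]]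
    by (simp add: signed_perms_def tau_uminus signed_perms_minus[OF assms])
  then show ?thesis using assms by (auto simp: sort_step_def DES_B_def)
qed

lemma fold_sort_step_signed_perms:
  "\<pi> \<in> signed_perms n \<Longrightarrow> fold (sort_step n) xs \<pi> \<in> signed_perms n"
  by (induction xs arbitrary: \<pi>) (simp_all add: sort_step_signed_perms)

lemma bubble_B_signed_perms: "\<pi> \<in> signed_perms n \<Longrightarrow> bubble_B n \<pi> \<in> signed_perms n"
  unfolding bubble_B_def by (rule fold_sort_step_signed_perms)

section \<open>One pass in terms of running maxima\<close>

lemma sort_step_0:
  assumes "\<pi> \<in> signed_perms n" "0 < n" "1 \<le> j"
  shows "sort_step n 0 \<pi> j = (if j = 1 then \<bar>\<pi> 1\<bar> else \<pi> j)"
  using assms signed_perms_minus[OF assms(1), of 1]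
  by (auto simp: sort_step_def DES_B_def tau_def transpose_def)

lemma sort_step_pos:
  assumes "0 < i" "i < n" "1 \<le> j"
  shows "sort_step n i \<pi> j =
    (if j = int i then min (\<pi> (int i)) (\<pi> (int i + 1))
     else if j = int i + 1 then max (\<pi> (int i)) (\<pi> (int i + 1)) else \<pi> j)"
  using assms by (auto simp: sort_step_def DES_B_def tau_def transpose_def)

text \<open>The maximum starts at \<open>\<bar>\<pi> 1\<bar>\<close> because the step with index 0
  makes the first entry positive. The values at 0 and 1 agree, since
  \<open>\<pi> 1 \<le> \<bar>\<pi> 1\<bar>\<close>.\<close>

fun prefix_max :: "(int \<Rightarrow> int) \<Rightarrow> nat \<Rightarrow> int" where
  "prefix_max \<pi> 0 = \<bar>\<pi> 1\<bar>"
| "prefix_max \<pi> (Suc j) = max (prefix_max \<pi> j) (\<pi> (int j + 1))"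

lemma prefix_max_ge_abs: "\<bar>\<pi> 1\<bar> \<le> prefix_max \<pi> j"
  by (induction j) auto

lemma prefix_max_ge: "1 \<le> i \<Longrightarrow> i \<le> int j \<Longrightarrow> \<pi> i \<le> prefix_max \<pi> j"
proof (induction j)
  case (Suc j)
  show ?case
  proof (cases "i = int j + 1")
    case False
    then show ?thesis using Suc by auto
  qed simp
qed simp

text \<open>After the steps below \<open>m\<close>, position \<open>m\<close> holds the running
  maximum and later positions are untouched. Step \<open>m\<close> compares this maximum with
  \<open>\<pi> (m + 1)\<close>, leaves the smaller at \<open>m\<close> for good and carries the
  larger on.\<close>

lemma fold_sort_step_eq:
  assumes "\<pi> \<in> signed_perms n" "1 \<le> m" "m \<le> n" "1 \<le> j"
  shows "fold (sort_step n) [0..<m] \<pi> j =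
    (if j < int m then min (prefix_max \<pi> (nat j)) (\<pi> (j + 1))
     else if j = int m then prefix_max \<pi> m else \<pi> j)"
  using assms(2-4)
proof (induction m arbitrary: j rule: dec_induct)
  case base
  then show ?case using assms(1) by (auto simp: sort_step_0)
next
  case (step m)
  let ?\<rho> = "fold (sort_step n) [0..<m] \<pi>"
  have "fold (sort_step n) [0..<Suc m] \<pi> j = sort_step n m ?\<rho> j" by simp
  also have "\<dots> = (if j = int m then min (?\<rho> (int m)) (?\<rho> (int m + 1))
     else if j = int m + 1 then max (?\<rho> (int m)) (?\<rho> (int m + 1)) else ?\<rho> j)"
    using step.hyps step.prems by (intro sort_step_pos) auto
  finally show ?case
    using step by (auto simp: step.IH)
qed

lemma bubble_B_eq:
  assumes "\<pi> \<in> signed_perms n" "1 \<le> j" "j \<le> int n"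
  shows "bubble_B n \<pi> j =
    (if j < int n then min (prefix_max \<pi> (nat j)) (\<pi> (j + 1)) else prefix_max \<pi> n)"
  using fold_sort_step_eq[OF assms(1), of n j] assms unfolding bubble_B_def by auto

section \<open>The maximum drop and its zero case\<close>

lemma maxdrop_B_eq:
  assumes "\<pi> \<in> signed_perms n"
  shows "maxdrop_B n \<pi> = Max ((\<lambda>i. i - max (\<pi> i) 0) ` {1..int n})"
proof -
  have "{i - \<pi> i | i. 1 \<le> i \<and> i \<le> int n \<and> \<pi> i > 0} \<union> {i | i. 1 \<le> i \<and> i \<le> int n \<and> \<pi> i < 0}
      = (\<lambda>i. i - max (\<pi> i) 0) ` {1..int n}" (is "?L = ?R")
  proof
    show "?L \<subseteq> ?R" by (force simp: image_iff)
    show "?R \<subseteq> ?L"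
    proof
      fix x assume "x \<in> ?R"
      then obtain i where i: "1 \<le> i" "i \<le> int n" "x = i - max (\<pi> i) 0" by auto
      \<comment> \<open>No entry at a positive position is zero, so every index belongs to one of
        the two families.\<close>
      moreover have "\<pi> i \<noteq> 0" using signed_perms_eq_0_iff[OF assms] i by auto
      ultimately show "x \<in> ?L" by (cases "\<pi> i > 0") auto
    qed
  qed
  then show ?thesis by (simp add: maxdrop_B_def)
qed

lemma drop_le_maxdrop_B:
  assumes "\<pi> \<in> signed_perms n" "1 \<le> i" "i \<le> int n"
  shows "i - max (\<pi> i) 0 \<le> maxdrop_B n \<pi>"
  unfolding maxdrop_B_eq[OF assms(1)] using assms by (intro Max_ge) auto

lemma maxdrop_B_attained:
  assumes "\<pi> \<in> signed_perms n" "1 \<le> n"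
  obtains i where "1 \<le> i" "i \<le> int n" "maxdrop_B n \<pi> = i - max (\<pi> i) 0"
proof -
  have "maxdrop_B n \<pi> \<in> (\<lambda>i. i - max (\<pi> i) 0) ` {1..int n}"
    unfolding maxdrop_B_eq[OF assms(1)] using assms(2) by (intro Max_in) auto
  then show thesis using that by auto
qed

text \<open>Position \<open>n\<close> alone gives a nonnegative drop, as its entry is at most
  \<open>n\<close>.\<close>

lemma maxdrop_B_nonneg:
  assumes "\<pi> \<in> signed_perms n" "1 \<le> n"
  shows "0 \<le> maxdrop_B n \<pi>"
  using drop_le_maxdrop_B[OF assms(1), of "int n"] signed_perms_abs_le[OF assms(1), of "int n"]
    assms(2) by auto

lemma maxdrop_B_id: "1 \<le> n \<Longrightarrow> maxdrop_B n id = 0"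
proof -
  assume n: "1 \<le> n"
  have id: "id \<in> signed_perms n" by (simp add: signed_perms_def permutes_id)
  obtain i where "1 \<le> i" "maxdrop_B n id = i - max (id i) 0"
    using maxdrop_B_attained[OF id n] by metis
  then show ?thesis by simp
qed

text \<open>Without a positive drop no entry at a positive position lies below its index, so
  \<open>\<pi>\<close> permutes \<open>{1..int n}\<close> without decreasing any element and hence
  fixes each one.\<close>

lemma maxdrop_B_le_0_imp_id:
  assumes p: "\<pi> \<in> signed_perms n" and le: "maxdrop_B n \<pi> \<le> 0"
  shows "\<pi> = id"
proof -
  let ?S = "{1..int n}"
  \<comment> \<open>From \<open>i \<le> max (\<pi> i) 0\<close> and \<open>i \<ge> 1\<close>, the
    maximum must be \<open>\<pi> i\<close>.\<close>
  have ge: "i \<le> \<pi> i" if "i \<in> ?S" for i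
    using drop_le_maxdrop_B[OF p, of i] le that by auto
  have sub: "\<pi> ` ?S \<subseteq> ?S"
  proof
    fix x assume "x \<in> \<pi> ` ?S"
    then obtain i where i: "i \<in> ?S" "x = \<pi> i" by auto
    then show "x \<in> ?S" using ge[of i] signed_perms_abs_le[OF p, of i] by auto
  qed
  have inj: "inj_on \<pi> ?S" using signed_perms_inject[OF p] by (auto intro: inj_onI)
  have "\<pi> ` ?S = ?S" using endo_inj_surj[OF _ sub inj] by simp
  \<comment> \<open>Nonnegative differences \<open>\<pi> i - i\<close> with total 0 all
    vanish.\<close>
  then have "sum \<pi> ?S = \<Sum>?S" using sum.reindex[OF inj, of "\<lambda>x. x"] by simp
  then have "(\<Sum>i\<in>?S. \<pi> i - i) = 0" by (simp add: sum_subtractf)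
  then have fix_pos: "\<pi> i = i" if "i \<in> ?S" for i
    using sum_nonneg_eq_0_iff[of ?S "\<lambda>i. \<pi> i - i"] ge that by fastforce
  show ?thesis
  proof
    fix i
    consider "i \<in> ?S" | "- i \<in> ?S" | "i = 0" | "i \<notin> {- int n..int n}" by fastforce
    then show "\<pi> i = id i"
    proof cases
      case 2
      then show ?thesis using fix_pos[of "- i"] signed_perms_minus[OF p, of i] by simp
    next
      case 4
      then show ?thesis using permutes_not_in[OF signed_perms_permutes[OF p]] by simp
    qed (use fix_pos p in simp_all)
  qed
qed

section \<open>Effect of one pass on the maximum drop\<close>

lemma last_negative_position:
  fixes \<pi> :: "int \<Rightarrow> int"
  assumes "1 \<le> j"
  obtains i where "1 \<le> i" "i \<le> j" "i = 1 \<or> \<pi> i < 0" "\<And>k. i < k \<Longrightarrow> k \<le> j \<Longrightarrow> 0 \<le> \<pi> k"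
proof -
  \<comment> \<open>The element 1 is the default when no entry up to \<open>j\<close> is
    negative.\<close>
  let ?N = "insert 1 ({1..j} \<inter> {i. \<pi> i < 0})"
  have fin: "finite ?N" by simp
  have "Max ?N \<in> ?N" by (rule Max_in[OF fin]) simp
  moreover have "0 \<le> \<pi> k" if "Max ?N < k" "k \<le> j" for k
  proof (rule ccontr)
    have "1 \<le> Max ?N" by (rule Max_ge[OF fin]) simp
    moreover assume "\<not> 0 \<le> \<pi> k"
    ultimately have "k \<in> ?N" using that by auto
    then have "k \<le> Max ?N" by (rule Max_ge[OF fin])
    with that(1) show False by linarith
  qed
  ultimately show thesis using assms that[of "Max ?N"] by auto
qed

lemma prefix_max_lower_bound:
  assumes p: "\<pi> \<in> signed_perms n" and D: "1 \<le> maxdrop_B n \<pi>" and j: "1 \<le> j" "j \<le> int n"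
  shows "j - prefix_max \<pi> (nat j) \<le> maxdrop_B n \<pi> - 1"
proof -
  obtain i where i: "1 \<le> i" "i \<le> j" "i = 1 \<or> \<pi> i < 0" "\<And>k. i < k \<Longrightarrow> k \<le> j \<Longrightarrow> 0 \<le> \<pi> k"
    using last_negative_position[OF j(1)] by metis
  \<comment> \<open>Position 1 counts whatever its sign, since it enters the running maximum by
    absolute value. As \<open>1 \<le> i\<close>, it is not in \<open>{i<..j}\<close>, so the set has
    \<open>j - i + 1\<close> elements.\<close>
  let ?A = "insert 1 {i<..j}"
  have "(\<lambda>k. \<bar>\<pi> k\<bar>) ` ?A \<subseteq> {1..prefix_max \<pi> (nat j)}"
  proof
    fix x assume "x \<in> (\<lambda>k. \<bar>\<pi> k\<bar>) ` ?A"
    then obtain k where k: "k \<in> ?A" "x = \<bar>\<pi> k\<bar>" by blast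
    have "\<pi> k \<noteq> 0" using signed_perms_eq_0_iff[OF p] k(1) i(1) by auto
    moreover have "x \<le> prefix_max \<pi> (nat j)"
    proof (cases "k = 1")
      case True
      then show ?thesis using prefix_max_ge_abs k(2) by simp
    next
      case False
      then show ?thesis using prefix_max_ge[of k "nat j" \<pi>] i(1) i(4)[of k] k by auto
    qed
    ultimately show "x \<in> {1..prefix_max \<pi> (nat j)}" using k(2) by auto
  qed
  moreover have "inj_on (\<lambda>k. \<bar>\<pi> k\<bar>) ?A"
    using i(1) by (intro signed_perms_inj_on_abs[OF p]) auto
  ultimately have "card ?A \<le> card {1..prefix_max \<pi> (nat j)}"
    by (intro card_inj_on_le) auto
  moreover have "card ?A = Suc (nat (j - i))" using i(1) by simp
  ultimately have "j - i + 1 \<le> prefix_max \<pi> (nat j)" using i(2) by simp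
  \<comment> \<open>For \<open>i = 1\<close> this is the assumption \<open>D\<close>; otherwise
    \<open>\<pi> i\<close> is negative and the drop at \<open>i\<close> is \<open>i\<close>
    itself.\<close>
  moreover have "i \<le> maxdrop_B n \<pi>"
    using i(1-3) D drop_le_maxdrop_B[OF p, of i] j by auto
  ultimately show ?thesis by simp
qed

text \<open>The upper bound examines a position \<open>j\<close> of maximum drop after the pass; the
  lower bound follows a position \<open>i\<close> of maximum drop before the pass to
  \<open>i - 1\<close>.\<close>

lemma maxdrop_B_bubble_B:
  assumes n: "1 \<le> n" and p: "\<pi> \<in> signed_perms n" and ne: "\<pi> \<noteq> id"
  shows "maxdrop_B n (bubble_B n \<pi>) = maxdrop_B n \<pi> - 1"
proof (rule antisym)
  have D: "1 \<le> maxdrop_B n \<pi>" using maxdrop_B_le_0_imp_id[OF p] ne by force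
  have q: "bubble_B n \<pi> \<in> signed_perms n" by (rule bubble_B_signed_perms[OF p])
  obtain j where j: "1 \<le> j" "j \<le> int n"
    "maxdrop_B n (bubble_B n \<pi>) = j - max (bubble_B n \<pi> j) 0"
    using maxdrop_B_attained[OF q n] by metis
  have lb: "j - prefix_max \<pi> (nat j) \<le> maxdrop_B n \<pi> - 1"
    by (rule prefix_max_lower_bound[OF p D j(1,2)])
  show "maxdrop_B n (bubble_B n \<pi>) \<le> maxdrop_B n \<pi> - 1"
  proof (cases "j < int n")
    case True
    have "j + 1 - max (\<pi> (j + 1)) 0 \<le> maxdrop_B n \<pi>"
      using True j by (intro drop_le_maxdrop_B[OF p]) auto
    then show ?thesis using True lb j(3) bubble_B_eq[OF p j(1,2)]
      by (auto simp: min_def max_def split: if_splits)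
  next
    case False
    then have "j = int n" using j by simp
    then show ?thesis using lb j bubble_B_eq[OF p j(1,2)] by auto
  qed
  obtain i where i: "1 \<le> i" "i \<le> int n" "maxdrop_B n \<pi> = i - max (\<pi> i) 0"
    using maxdrop_B_attained[OF p n] by metis
  show "maxdrop_B n \<pi> - 1 \<le> maxdrop_B n (bubble_B n \<pi>)"
  proof (cases "i = 1")
    case True
    \<comment> \<open>There is no position \<open>i - 1\<close> to use, but the drop at 1 is at most
      1, so nonnegativity suffices.\<close>
    then show ?thesis using i maxdrop_B_nonneg[OF q n] by simp
  next
    case False
    \<comment> \<open>The new entry at \<open>i - 1\<close> is a minimum that has
      \<open>\<pi> i\<close> as one argument.\<close>
    have "max (bubble_B n \<pi> (i - 1)) 0 \<le> max (\<pi> i) 0"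
      using False i bubble_B_eq[OF p, of "i - 1"] by auto
    moreover have "i - 1 - max (bubble_B n \<pi> (i - 1)) 0 \<le> maxdrop_B n (bubble_B n \<pi>)"
      using False i by (intro drop_le_maxdrop_B[OF q]) auto
    ultimately show ?thesis using i by simp
  qed
qed

section \<open>Iterated passes and the sorting complexity\<close>

lemma funpow_bubble_B_signed_perms:
  "\<pi> \<in> signed_perms n \<Longrightarrow> (bubble_B n ^^ k) \<pi> \<in> signed_perms n"
  by (induction k) (simp_all add: bubble_B_signed_perms)

text \<open>The bound on \<open>k\<close> keeps the drop positive before each of the
  \<open>k\<close> passes, so none of them starts at \<open>id\<close> and each lowers the drop by
  one.\<close>

lemma maxdrop_B_funpow_bubble_B:
  assumes "1 \<le> n" "\<pi> \<in> signed_perms n" "int k \<le> maxdrop_B n \<pi>"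
  shows "maxdrop_B n ((bubble_B n ^^ k) \<pi>) = maxdrop_B n \<pi> - int k"
  using assms(3)
proof (induction k)
  case (Suc k)
  then have IH: "maxdrop_B n ((bubble_B n ^^ k) \<pi>) = maxdrop_B n \<pi> - int k" by simp
  then have "(bubble_B n ^^ k) \<pi> \<noteq> id" using maxdrop_B_id[OF assms(1)] Suc.prems by auto
  then show ?case
    using maxdrop_B_bubble_B[OF assms(1) funpow_bubble_B_signed_perms[OF assms(2)]] IH by simp
qed simp

lemma maxdrop_B_eq_bsc_B:
  assumes n: "1 \<le> n" and p: "\<pi> \<in> signed_perms n"
  shows "maxdrop_B n \<pi> = int (bsc_B n \<pi>)"
proof -
  define d where "d = nat (maxdrop_B n \<pi>)"
  have d: "maxdrop_B n \<pi> = int d" using maxdrop_B_nonneg[OF p n] by (simp add: d_def)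
  have "bsc_B n \<pi> = d"
    unfolding bsc_B_def
  proof (rule Least_equality)
    show "(bubble_B n ^^ d) \<pi> = id"
      using maxdrop_B_funpow_bubble_B[OF n p, of d] d
      by (intro maxdrop_B_le_0_imp_id[OF funpow_bubble_B_signed_perms[OF p]]) simp
  next
    fix k assume "(bubble_B n ^^ k) \<pi> = id"
    \<comment> \<open>If \<open>k < d\<close>, the drop after \<open>k\<close> passes would be
      \<open>d - k > 0\<close>, whereas \<open>id\<close> has drop 0.\<close>
    then show "d \<le> k"
      using maxdrop_B_funpow_bubble_B[OF n p, of k] d maxdrop_B_id[OF n] by fastforce
  qed
  with d show ?thesis by simp
qed

theorem proposition2p3:
  fixes n :: nat
  assumes "n \<ge> 1"
  shows "(\<forall>\<pi>\<in>signed_perms n. \<pi> \<noteq> id \<longrightarrow>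
            maxdrop_B n (bubble_B n \<pi>) = maxdrop_B n \<pi> - 1) \<and>
         (\<forall>\<pi>\<in>signed_perms n. maxdrop_B n \<pi> = int (bsc_B n \<pi>))"
  using maxdrop_B_bubble_B[OF assms] maxdrop_B_eq_bsc_B[OF assms] by blast

end
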